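(* Let $0<q<1$ and $\nu>-1$. For every $f\in\mathcal{L}_{q,2,\nu}$ one has $\|\mathcal{F}_{q,\nu}f\|_{q,2,\nu}=\|f\|_{q,2,\nu}$.
   Context: $\mathbb{R}_q^+=\{q^n: n\in\mathbb{Z}\}$. For $a\in\mathbb{C}$, $(a;q^2)_n=\prod_{k=0}^{n-1}(1-aq^{2k})$ and $(a;q^2)_\infty=\prod_{k\ge 0}(1-aq^{2k})$. Jackson integral: $\int_0^\infty f(t)\,d_qt=(1-q)\sum_{n\in\mathbb{Z}}q^nf(q^n)$. $\mathcal{L}_{q,2,\nu}$ is the space of functions $f:\mathbb{R}_q^+\to\mathbb{R}$ with $\|f\|_{q,2,\nu}=\left(\int_0^\infty|f(x)|^2x^{2\nu+1}d_qx\right)^{1/2}<\infty$. Normalized $q$-Bessel function: $j_\nu(x,q^2)=\sum_{n=0}^\infty(-1)^n\frac{q^{n(n+1)}}{(q^{2\nu+2};q^2)_n(q^2;q^2)_n}x^{2n}$. Put $c_{q,\nu}=\frac{1}{1-q}\frac{(q^{2\nu+2};q^2)_\infty}{(q^2;q^2)_\infty}$. The $q$-Bessel Fourier transform is $\mathcal{F}_{q,\nu}f(x)=c_{q,\nu}\int_0^\infty f(t)j_\nu(xt,q^2)t^{2\nu+1}d_qt$, $x\in\mathbb{R}_q^+$. *)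

theory Defs
  imports "HOL-Analysis.Analysis"
begin

definition Rq_plus :: "real \<Rightarrow> real set" where
  "Rq_plus q = {q powi n | n :: int. True}"

definition qpoch :: "'a :: real_normed_field \<Rightarrow> 'a \<Rightarrow> nat \<Rightarrow> 'a" where
  "qpoch a p n = (\<Prod>k<n. 1 - a * p ^ k)"

definition qpoch_inf :: "'a :: real_normed_field \<Rightarrow> 'a \<Rightarrow> 'a" where
  "qpoch_inf a p = (\<Prod>k. 1 - a * p ^ k)"

text \<open>
  Functions on \<open>Rq_plus q\<close> are modelled as total functions on the reals; every notion below
  depends only on their values on \<open>Rq_plus q\<close>. The bilateral series of the Jackson integral
  is an unordered sum, so for real functions convergence means absolute convergence.
\<close>

definition jackson_integrable :: "real \<Rightarrow> (real \<Rightarrow> real) \<Rightarrow> bool" where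
  "jackson_integrable q f \<longleftrightarrow> (\<lambda>n :: int. q powi n * f (q powi n)) summable_on UNIV"

definition jackson_integral :: "real \<Rightarrow> (real \<Rightarrow> real) \<Rightarrow> real" where
  "jackson_integral q f = (1 - q) * (\<Sum>\<^sub>\<infinity>n :: int. q powi n * f (q powi n))"

definition Lq2_space :: "real \<Rightarrow> real \<Rightarrow> (real \<Rightarrow> real) set" where
  "Lq2_space q \<nu> = {f. jackson_integrable q (\<lambda>x. \<bar>f x\<bar>\<^sup>2 * x powr (2 * \<nu> + 1))}"

definition Lq2_norm :: "real \<Rightarrow> real \<Rightarrow> (real \<Rightarrow> real) \<Rightarrow> real" where
  "Lq2_norm q \<nu> f = sqrt (jackson_integral q (\<lambda>x. \<bar>f x\<bar>\<^sup>2 * x powr (2 * \<nu> + 1)))"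

definition qBessel :: "real \<Rightarrow> real \<Rightarrow> real \<Rightarrow> real" where
  "qBessel q \<nu> x =
     (\<Sum>n. (-1) ^ n * q ^ (n * (n + 1))
        / (qpoch (q powr (2 * \<nu> + 2)) (q\<^sup>2) n * qpoch (q\<^sup>2) (q\<^sup>2) n) * x ^ (2 * n))"

definition qBessel_const :: "real \<Rightarrow> real \<Rightarrow> real" where
  "qBessel_const q \<nu> =
     1 / (1 - q) * (qpoch_inf (q powr (2 * \<nu> + 2)) (q\<^sup>2) / qpoch_inf (q\<^sup>2) (q\<^sup>2))"

definition qBessel_Fourier :: "real \<Rightarrow> real \<Rightarrow> (real \<Rightarrow> real) \<Rightarrow> real \<Rightarrow> real" where
  "qBessel_Fourier q \<nu> f x =
     qBessel_const q \<nu> * jackson_integral q (\<lambda>t. f t * qBessel q \<nu> (x * t) * t powr (2 * \<nu> + 1))"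

end

(*
Put p = q^2, b = q^(nu+1) and g(n) = f(q^n) b^n. Up to the reflection n -> -n of the argument, the
transform becomes convolution on the integers with the kernel
K(k) = (b^2;p)_inf / (p;p)_inf * b^k * j_nu(q^k; q^2), and the two norms become l^2 norms. Euler's
formulas show that K is the correlation K(k) = sum_n e(n) h(n+k) of the coefficient sequences of
(bz;p)_inf and 1/(bz;p)_inf, which are inverse to each other under convolution. Therefore the
autocorrelation of K is (e * h) correlated with (e * h), that is, the unit mass at 0: the translates
of K are orthonormal, and since K is absolutely summable, expanding the square of the norm and
interchanging the sums shows that convolution with K preserves the l^2 norm.
*)
theory Submission
  imports Defs
begin


section \<open>Unordered sums of real families\<close>

lemma summable_on_real_comparison:
  fixes f g :: "'a \<Rightarrow> real"
  assumes "g summable_on A" "\<And>x. x \<in> A \<Longrightarrow> \<bar>f x\<bar> \<le> g x"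
  shows "f summable_on A"
proof -
  have "(\<lambda>x. \<bar>f x\<bar>) summable_on A"
    by (rule summable_on_comparison_test[OF assms]) auto
  then show ?thesis
    using summable_on_iff_abs_summable_on_real[of f A] by simp
qed

lemma summable_on_real_abs:
  fixes f :: "'a \<Rightarrow> real"
  assumes "f summable_on A"
  shows "(\<lambda>x. \<bar>f x\<bar>) summable_on A"
  using assms summable_on_iff_abs_summable_on_real[of f A] by simp

lemma summable_on_times:
  fixes f :: "'a \<Rightarrow> real" and g :: "'b \<Rightarrow> real"
  assumes "f summable_on A" "g summable_on B"
  shows "(\<lambda>(x, y). f x * g y) summable_on A \<times> B"
proof (rule summable_on_real_comparison)
  show "(\<lambda>(x, y). \<bar>f x\<bar> * \<bar>g y\<bar>) summable_on A \<times> B"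
    by (rule summable_on_SigmaI[where g = "\<lambda>x. \<bar>f x\<bar> * infsum (\<lambda>y. \<bar>g y\<bar>) B"])
       (auto intro!: has_sum_cmult_right has_sum_infsum summable_on_cmult_left
          summable_on_real_abs assms)
qed (auto simp: abs_mult)

lemma has_sum_times:
  fixes f :: "'a \<Rightarrow> real" and g :: "'b \<Rightarrow> real"
  assumes "(f has_sum a) A" "(g has_sum b) B"
  shows "((\<lambda>(x, y). f x * g y) has_sum a * b) (A \<times> B)"
proof (rule has_sum_SigmaI)
  show "((\<lambda>x. f x * b) has_sum a * b) A"
    by (intro has_sum_cmult_left assms)
  show "(\<lambda>(x, y). f x * g y) summable_on A \<times> B"
    using assms by (auto intro: summable_on_times has_sum_imp_summable)
qed (auto intro: has_sum_cmult_right assms)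

lemma summable_on_bounded:
  fixes f :: "'a \<Rightarrow> real"
  assumes "f summable_on UNIV"
  obtains B where "\<And>x. \<bar>f x\<bar> \<le> B"
proof
  show "\<bar>f x\<bar> \<le> infsum (\<lambda>x. \<bar>f x\<bar>) UNIV" for x
    using finite_sum_le_infsum[of "\<lambda>x. \<bar>f x\<bar>" UNIV "{x}"] summable_on_real_abs[OF assms] by simp
qed

lemma summable_on_power2:
  fixes f :: "'a \<Rightarrow> real"
  assumes "f summable_on UNIV"
  shows "(\<lambda>x. (f x)\<^sup>2) summable_on UNIV"
proof -
  obtain B where B: "\<And>x. \<bar>f x\<bar> \<le> B" using summable_on_bounded[OF assms] by blast
  show ?thesis
  proof (rule summable_on_real_comparison)
    show "(\<lambda>x. B * \<bar>f x\<bar>) summable_on UNIV"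
      by (intro summable_on_cmult_right summable_on_real_abs assms)
    show "\<bar>(f x)\<^sup>2\<bar> \<le> B * \<bar>f x\<bar>" for x
      using mult_right_mono[OF B[of x], of "\<bar>f x\<bar>"] by (simp add: power2_eq_square abs_mult)
  qed
qed

lemma abs_mult_le_power2_sum:
  fixes x y :: real
  shows "\<bar>x * y\<bar> \<le> x\<^sup>2 + y\<^sup>2"
proof -
  have "2 * \<bar>x * y\<bar> \<le> x\<^sup>2 + y\<^sup>2"
    using sum_squares_bound[of "\<bar>x\<bar>" "\<bar>y\<bar>"] by (simp add: abs_mult)
  then show ?thesis
    using abs_ge_zero[of "x * y"] by linarith
qed

lemma summable_on_mult_power2:
  fixes f g :: "'a \<Rightarrow> real"
  assumes "(\<lambda>x. (f x)\<^sup>2) summable_on A" "(\<lambda>x. (g x)\<^sup>2) summable_on A"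
  shows "(\<lambda>x. f x * g x) summable_on A"
proof (rule summable_on_real_comparison)
  show "(\<lambda>x. (f x)\<^sup>2 + (g x)\<^sup>2) summable_on A"
    by (intro summable_on_add assms)
  show "\<bar>f x * g x\<bar> \<le> (f x)\<^sup>2 + (g x)\<^sup>2" for x
    by (rule abs_mult_le_power2_sum)
qed

section \<open>Correlations of sequences on the integers and orthonormal translates\<close>

lemma correlation_summable:
  fixes e h :: "int \<Rightarrow> real"
  assumes "e summable_on UNIV" "h summable_on UNIV"
  shows "(\<lambda>n. e n * h (n + k)) summable_on UNIV"
proof (rule summable_on_mult_power2)
  have "(\<lambda>n. (h (n + k))\<^sup>2) summable_on UNIV \<longleftrightarrow> (\<lambda>n. (h n)\<^sup>2) summable_on UNIV"
    by (rule summable_on_reindex_bij_witness[of _ "\<lambda>n. n - k" "\<lambda>n. n + k"]) auto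
  then show "(\<lambda>n. (h (n + k))\<^sup>2) summable_on UNIV"
    using summable_on_power2[OF assms(2)] by simp
qed (intro summable_on_power2 assms)

text \<open>In the triple sum for \<open>K m * K (m + d)\<close> put \<open>i = n + m\<close>. For
  fixed \<open>n'\<close> and \<open>i\<close> the sum over \<open>n\<close> becomes the convolution
  at \<open>n' + i + d\<close>, a unit mass by \<open>inverse\<close>. What survives is again a
  convolution, now at \<open>- d\<close>.\<close>

lemma correlation_of_inverses:
  fixes e h :: "int \<Rightarrow> real"
  assumes e: "e summable_on UNIV" and h: "h summable_on UNIV"
    and inverse: "\<And>s. ((\<lambda>n. e n * h (s - n)) has_sum of_bool (s = 0)) UNIV"
  defines "K \<equiv> \<lambda>k. \<Sum>\<^sub>\<infinity>n. e n * h (n + k)"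
  shows "K summable_on UNIV"
    and "((\<lambda>m. K m * K (m + d)) has_sum of_bool (d = 0)) UNIV"
proof -
  note corr = correlation_summable[OF e h]
  have K: "((\<lambda>n. e n * h (n + k)) has_sum K k) UNIV" for k
    unfolding K_def by (rule has_sum_infsum[OF corr])
  \<comment> \<open>The shear \<open>(k, n)\<close> to \<open>(n, n + k)\<close> turns the family
    into a plain product.\<close>
  have "(\<lambda>(k, n). e n * h (n + k)) summable_on UNIV \<times> UNIV
      \<longleftrightarrow> (\<lambda>(n, i). e n * h i) summable_on UNIV \<times> UNIV"
    by (rule summable_on_reindex_bij_witness[of _ "\<lambda>(n, i). (i - n, n)" "\<lambda>(k, n). (n, n + k)"]) auto
  then have "(\<lambda>(k, n). e n * h (n + k)) summable_on UNIV \<times> UNIV"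
    using summable_on_times[OF e h] by blast
  then obtain S where "((\<lambda>(k, n). e n * h (n + k)) has_sum S) (UNIV \<times> UNIV)"
    by (auto simp: summable_on_def)
  from has_sum_SigmaD[OF this, of K] K show "K summable_on UNIV"
    by (auto intro: has_sum_imp_summable)
  define Q where "Q = (\<lambda>(m, n, n'). (e n * h (n + m)) * (e n' * h (n' + (m + d))))"
  \<comment> \<open>The index \<open>n\<close> comes last here, so that
    \<open>has_sum_SigmaD\<close> sums over it first.\<close>
  define R where "R = (\<lambda>((n', i), n). (e n' * h i) * (e n * h ((n' + i + d) - n)))"
  have QR: "(Q has_sum S) (UNIV \<times> UNIV \<times> UNIV) \<longleftrightarrow> (R has_sum S) ((UNIV \<times> UNIV) \<times> UNIV)" for S
    by (rule has_sum_reindex_bij_witness[of _ "\<lambda>((n', i), n). (i - n, n, n')"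
          "\<lambda>(m, n, n'). ((n', n + m), n)"]) (auto simp: Q_def R_def algebra_simps)
  obtain B where B: "\<And>x. \<bar>h x\<bar> \<le> B" using summable_on_bounded[OF h] by blast
  \<comment> \<open>Bounding the last factor \<open>h\<close> by \<open>B\<close> leaves a product
    of three summable families in independent indices.\<close>
  have "R summable_on (UNIV \<times> UNIV) \<times> UNIV"
  proof (rule summable_on_real_comparison)
    have "(\<lambda>((n', i), n). (\<lambda>(n', i). e n' * h i) (n', i) * e n) summable_on (UNIV \<times> UNIV) \<times> UNIV"
      using summable_on_times[OF summable_on_times[OF e h] e] by (simp add: case_prod_unfold)
    from summable_on_cmult_right[OF summable_on_real_abs[OF this], of B]
    show "(\<lambda>((n', i), n). B * \<bar>e n' * h i * e n\<bar>) summable_on (UNIV \<times> UNIV) \<times> UNIV"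
      by (simp add: case_prod_unfold)
    show "\<bar>R x\<bar> \<le> (\<lambda>((n', i), n). B * \<bar>e n' * h i * e n\<bar>) x" for x
      using mult_left_mono[OF B, of "\<bar>e n' * h i * e n\<bar>" for n' i n]
      by (auto simp: R_def abs_mult mult_ac split: prod.splits)
  qed
  then obtain S where S: "(R has_sum S) ((UNIV \<times> UNIV) \<times> UNIV)"
    by (auto simp: summable_on_def)
  have R1: "((\<lambda>(n', i). (e n' * h i) * of_bool (n' + i + d = 0)) has_sum S) (UNIV \<times> UNIV)"
    by (rule has_sum_SigmaD[OF S]) (auto simp: R_def intro!: has_sum_cmult_right inverse)
  have "((\<lambda>i. (e n' * h i) * of_bool (n' + i + d = 0)) has_sum e n' * h (- d - n')) UNIV" for n'
    by (rule has_sum_finite_neutralI[of "{- d - n'}"]) auto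
  with has_sum_SigmaD[OF R1, of "\<lambda>n'. e n' * h (- d - n')"]
  have "((\<lambda>n'. e n' * h (- d - n')) has_sum S) UNIV"
    by simp
  with inverse[of "- d"] have "S = of_bool (d = 0)"
    by (simp add: has_sum_unique)
  \<comment> \<open>In the original order the sum over \<open>(n, n')\<close> factors for each
    \<open>m\<close>, so the same total \<open>S\<close> is the autocorrelation.\<close>
  moreover have "((\<lambda>m. K m * K (m + d)) has_sum S) UNIV"
  proof (rule has_sum_SigmaD[OF S[folded QR]])
    show "((\<lambda>y. Q (m, y)) has_sum K m * K (m + d)) (UNIV \<times> UNIV)" for m
      using has_sum_times[OF K[of m] K[of "m + d"]] by (simp add: Q_def case_prod_unfold)
  qed
  ultimately show "((\<lambda>m. K m * K (m + d)) has_sum of_bool (d = 0)) UNIV" by simp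
qed

text \<open>Expand the square as a double sum over \<open>i = m + n\<close> and a second such index
  \<open>j\<close>, then regroup by \<open>n = i - m\<close> and \<open>d = j - i\<close>. By
  \<open>orth\<close> the sum over \<open>i\<close> leaves only \<open>d = 0\<close>, that is, the
  squares of \<open>g n\<close>. Absolute summability of \<open>K\<close> justifies the
  interchange.\<close>

lemma has_sum_power2_orthonormal:
  fixes g K :: "int \<Rightarrow> real"
  assumes g: "(\<lambda>n. (g n)\<^sup>2) summable_on UNIV" and K: "K summable_on UNIV"
    and orth: "\<And>d. ((\<lambda>m. K m * K (m + d)) has_sum of_bool (d = 0)) UNIV"
  shows "(\<lambda>n. g n * K (m + n)) summable_on UNIV"
    and "((\<lambda>m. (\<Sum>\<^sub>\<infinity>n. g n * K (m + n))\<^sup>2) has_sum (\<Sum>\<^sub>\<infinity>n. (g n)\<^sup>2)) UNIV"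
proof -
  have sumK: "(\<lambda>n. g n * K (m + n)) summable_on UNIV" for m
  proof (rule summable_on_mult_power2[OF g])
    have "(\<lambda>n. (K (m + n))\<^sup>2) summable_on UNIV \<longleftrightarrow> (\<lambda>n. (K n)\<^sup>2) summable_on UNIV"
      by (rule summable_on_reindex_bij_witness[of _ "\<lambda>n. n - m" "\<lambda>n. m + n"]) auto
    then show "(\<lambda>n. (K (m + n))\<^sup>2) summable_on UNIV"
      using summable_on_power2[OF K] by simp
  qed
  then show "(\<lambda>n. g n * K (m + n)) summable_on UNIV" .
  define G where "G m = (\<Sum>\<^sub>\<infinity>n. g n * K (m + n))" for m
  have G: "((\<lambda>i. g (i - m) * K i) has_sum G m) UNIV" for m
  proof -
    have "((\<lambda>n. g n * K (m + n)) has_sum G m) UNIV"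
      unfolding G_def by (rule has_sum_infsum[OF sumK])
    also have "?this \<longleftrightarrow> ?thesis"
      by (rule has_sum_reindex_bij_witness[of _ "\<lambda>n. n - m" "\<lambda>n. m + n"]) auto
    finally show ?thesis .
  qed
  define T where "T = (\<lambda>(m, i, j). (g (i - m) * K i) * (g (j - m) * K j))"
  define R where "R = (\<lambda>((n, d), i). (g n * g (n + d)) * (K i * K (i + d)))"
  \<comment> \<open>The family \<open>T\<close> is majorised by \<open>U\<close> plus its mirror
    image in \<open>i\<close> and \<open>j\<close>. Shifting \<open>m\<close> makes \<open>U\<close>
    a product of the summable families \<open>(g n)\<^sup>2\<close>, \<open>\<bar>K i\<bar>\<close>
    and \<open>\<bar>K j\<bar>\<close>.\<close>
  define U where "U = (\<lambda>(m, i, j). (g (i - m))\<^sup>2 * (\<bar>K i\<bar> * \<bar>K j\<bar>))"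
  have TR: "(T has_sum S) (UNIV \<times> UNIV \<times> UNIV) \<longleftrightarrow> (R has_sum S) ((UNIV \<times> UNIV) \<times> UNIV)" for S
    by (rule has_sum_reindex_bij_witness[of _ "\<lambda>((n, d), i). (i - n, i, i + d)"
          "\<lambda>(m, i, j). ((i - m, j - i), i)"]) (auto simp: T_def R_def algebra_simps)
  note absK = summable_on_real_abs[OF K]
  have "U summable_on UNIV \<times> UNIV \<times> UNIV
      \<longleftrightarrow> (\<lambda>(n, i, j). (g n)\<^sup>2 * (\<bar>K i\<bar> * \<bar>K j\<bar>)) summable_on UNIV \<times> UNIV \<times> UNIV"
    by (rule summable_on_reindex_bij_witness[of _ "\<lambda>(n, i, j). (i - n, i, j)"
          "\<lambda>(m, i, j). (i - m, i, j)"]) (auto simp: U_def)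
  also have "\<dots>"
    using summable_on_times[OF g summable_on_times[OF absK absK]] by (simp add: case_prod_unfold)
  finally have U: "U summable_on UNIV \<times> UNIV \<times> UNIV" .
  have "U summable_on UNIV \<times> UNIV \<times> UNIV
      \<longleftrightarrow> (\<lambda>(m, i, j). U (m, j, i)) summable_on UNIV \<times> UNIV \<times> UNIV"
    by (rule summable_on_reindex_bij_witness[of _ "\<lambda>(m, i, j). (m, j, i)" "\<lambda>(m, i, j). (m, j, i)"]) auto
  with U have U': "(\<lambda>(m, i, j). U (m, j, i)) summable_on UNIV \<times> UNIV \<times> UNIV" by simp
  have "T summable_on UNIV \<times> UNIV \<times> UNIV"
  proof (rule summable_on_real_comparison[OF summable_on_add[OF U U']])
    fix x :: "int \<times> int \<times> int"
    obtain m i j where x: "x = (m, i, j)" by (cases x)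
    have "\<bar>g (i - m)\<bar> * \<bar>g (j - m)\<bar> \<le> (g (i - m))\<^sup>2 + (g (j - m))\<^sup>2"
      using abs_mult_le_power2_sum[of "g (i - m)" "g (j - m)"] by (simp add: abs_mult)
    then have "\<bar>g (i - m)\<bar> * \<bar>g (j - m)\<bar> * (\<bar>K i\<bar> * \<bar>K j\<bar>)
        \<le> ((g (i - m))\<^sup>2 + (g (j - m))\<^sup>2) * (\<bar>K i\<bar> * \<bar>K j\<bar>)"
      by (rule mult_right_mono) simp
    then show "\<bar>T x\<bar> \<le> U x + (\<lambda>(m, i, j). U (m, j, i)) x"
      by (simp add: x T_def U_def abs_mult algebra_simps)
  qed
  then obtain S where S: "(T has_sum S) (UNIV \<times> UNIV \<times> UNIV)"
    by (auto simp: summable_on_def)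
  have R1: "((\<lambda>(n, d). (g n * g (n + d)) * of_bool (d = 0)) has_sum S) (UNIV \<times> UNIV)"
    by (rule has_sum_SigmaD[OF S[unfolded TR]]) (auto simp: R_def intro!: has_sum_cmult_right orth)
  have "((\<lambda>d. (g n * g (n + d)) * of_bool (d = 0)) has_sum (g n)\<^sup>2) UNIV" for n
    by (rule has_sum_finite_neutralI[of "{0}"]) (auto simp: power2_eq_square)
  with has_sum_SigmaD[OF R1, of "\<lambda>n. (g n)\<^sup>2"]
  have "((\<lambda>n. (g n)\<^sup>2) has_sum S) UNIV"
    by simp
  then have "S = (\<Sum>\<^sub>\<infinity>n. (g n)\<^sup>2)"
    by (simp add: infsumI)
  moreover have "((\<lambda>m. (G m)\<^sup>2) has_sum S) UNIV"
  proof (rule has_sum_SigmaD[OF S])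
    show "((\<lambda>y. T (m, y)) has_sum (G m)\<^sup>2) (UNIV \<times> UNIV)" for m
      using has_sum_times[OF G[of m] G[of m]] by (simp add: T_def case_prod_unfold power2_eq_square)
  qed
  ultimately show "((\<lambda>m. (\<Sum>\<^sub>\<infinity>n. g n * K (m + n))\<^sup>2) has_sum (\<Sum>\<^sub>\<infinity>n. (g n)\<^sup>2)) UNIV"
    by (simp add: G_def)
qed


section \<open>Infinite products and Euler's expansion of (z;p)_inf\<close>

lemma convergent_prod_qpoch:
  fixes z p :: real
  assumes "0 < p" "p < 1"
  shows "convergent_prod (\<lambda>k. 1 - z * p ^ k)"
proof -
  have "summable (\<lambda>k. norm ((1 - z * p ^ k) - 1))"
    using assms by (auto simp: abs_mult intro!: summable_mult summable_geometric)
  then show ?thesis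
    by (intro abs_convergent_prod_imp_convergent_prod summable_imp_abs_convergent_prod)
qed

lemma qpoch_LIMSEQ:
  fixes z p :: real
  assumes "0 < p" "p < 1"
  shows "qpoch z p \<longlonglongrightarrow> qpoch_inf z p"
  using convergent_prod_LIMSEQ[OF convergent_prod_qpoch[OF assms, of z]]
  unfolding qpoch_inf_def qpoch_def by (simp add: LIMSEQ_lessThan_iff_atMost)

lemma qpoch_inf_eq_qpoch_mult:
  fixes z p :: real
  assumes "0 < p" "p < 1"
  shows "qpoch_inf z p = qpoch z p n * qpoch_inf (z * p ^ n) p"
proof (rule LIMSEQ_unique)
  show "(\<lambda>m. qpoch z p (m + n)) \<longlonglongrightarrow> qpoch_inf z p"
    by (intro LIMSEQ_ignore_initial_segment qpoch_LIMSEQ assms)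
  have "qpoch z p (m + n) = qpoch z p n * qpoch (z * p ^ n) p m" for m
    by (induction m) (auto simp: qpoch_def power_add mult_ac)
  then show "(\<lambda>m. qpoch z p (m + n)) \<longlonglongrightarrow> qpoch z p n * qpoch_inf (z * p ^ n) p"
    by (auto intro!: tendsto_mult_left qpoch_LIMSEQ assms)
qed

lemma qpoch_pos:
  fixes z p :: real
  assumes "0 < p" "p < 1" "z < 1"
  shows "qpoch z p n > 0"
  unfolding qpoch_def
proof (intro prod_pos ballI)
  fix k
  have "z * p ^ k < 1"
  proof (cases "z \<le> 0")
    case True
    then have "z * p ^ k \<le> 0"
      using assms by (simp add: mult_nonpos_nonneg)
    then show ?thesis by simp
  next
    case False
    then have "z * p ^ k \<le> z * 1"
      using assms by (intro mult_left_mono power_le_one) auto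
    then show ?thesis using assms by simp
  qed
  then show "0 < 1 - z * p ^ k" by simp
qed

lemma qpoch_inf_nonzero:
  fixes z p :: real
  assumes "0 < p" "p < 1" "z < 1"
  shows "qpoch_inf z p \<noteq> 0"
  unfolding qpoch_inf_def
proof (rule prodinf_nonzero)
  show "1 - z * p ^ k \<noteq> 0" for k
    using qpoch_pos[OF assms, of "Suc k"] by (auto simp: qpoch_def)
qed (intro convergent_prod_qpoch assms)

text \<open>The coefficient $(-1)^n p^{n(n-1)/2} / (p;p)_n$ of $z^n$ in $(z;p)_\infty$.\<close>

definition euler_coeff :: "real \<Rightarrow> nat \<Rightarrow> real" where
  "euler_coeff p n = (\<Prod>k<n. - (p ^ k) / (1 - p ^ Suc k))"

lemma euler_coeff_0 [simp]: "euler_coeff p 0 = 1"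
  by (simp add: euler_coeff_def)

text \<open>This is the functional equation E(z) = (1 - z) E(p z) of the Euler series, read off at
  z^(n+1).\<close>

lemma euler_coeff_Suc:
  assumes "0 < p" "p < 1"
  shows "euler_coeff p (Suc n) * (1 - p ^ Suc n) = - (p ^ n) * euler_coeff p n"
proof -
  have "p ^ Suc n < 1"
    using assms by (intro power_Suc_less_one) auto
  then show ?thesis by (simp add: euler_coeff_def field_simps)
qed

text \<open>Serves to recognise the terms of \<open>qBessel\<close>: for p = q^2 the exponents add
  up to n(n-1) + 2n = n(n+1).\<close>

lemma euler_coeff_eq:
  "euler_coeff (q\<^sup>2) n * (q\<^sup>2) ^ n = (-1) ^ n * q ^ (n * (n + 1)) / qpoch (q\<^sup>2) (q\<^sup>2) n"
proof (induction n)
  case (Suc n)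
  have "euler_coeff (q\<^sup>2) (Suc n) * (q\<^sup>2) ^ Suc n
      = (euler_coeff (q\<^sup>2) n * (q\<^sup>2) ^ n) * (- ((q\<^sup>2) ^ Suc n) / (1 - (q\<^sup>2) ^ Suc n))"
    by (simp add: euler_coeff_def)
  also have "\<dots> = (-1) ^ Suc n * (q ^ (n * (n + 1)) * (q\<^sup>2) ^ Suc n)
      / (qpoch (q\<^sup>2) (q\<^sup>2) n * (1 - q\<^sup>2 * (q\<^sup>2) ^ n))"
    by (simp add: Suc.IH)
  also have "q ^ (n * (n + 1)) * (q\<^sup>2) ^ Suc n = q ^ (Suc n * (Suc n + 1))"
    unfolding power_mult[symmetric] power_add[symmetric] by (rule arg_cong[where f = "power q"]) simp
  finally show ?case
    by (simp add: qpoch_def del: power_Suc)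
qed (simp add: qpoch_def)

text \<open>The ratio of consecutive terms tends to 0 whatever \<open>z\<close> is, so the series
  converges on the whole line.\<close>

lemma summable_norm_euler_coeff:
  assumes "0 < p" "p < 1"
  shows "summable (\<lambda>n. norm (euler_coeff p n * z ^ n))"
proof -
  have "(\<lambda>n. p ^ n * \<bar>z\<bar> / (1 - p ^ Suc n)) \<longlonglongrightarrow> 0 * \<bar>z\<bar> / (1 - 0)"
    using assms by (intro tendsto_intros LIMSEQ_power_zero LIMSEQ_Suc[OF LIMSEQ_power_zero]) auto
  then have "\<forall>\<^sub>F n in sequentially. p ^ n * \<bar>z\<bar> / (1 - p ^ Suc n) < 1 / 2"
    by (rule order_tendstoD) simp
  then obtain N where N: "\<And>n. n \<ge> N \<Longrightarrow> p ^ n * \<bar>z\<bar> / (1 - p ^ Suc n) < 1 / 2"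
    unfolding eventually_sequentially by blast
  show ?thesis
  proof (rule summable_ratio_test[of "1 / 2" N])
    fix n assume n: "n \<ge> N"
    have "p ^ Suc n < 1"
      using assms by (intro power_Suc_less_one) auto
    then have "norm (euler_coeff p (Suc n) * z ^ Suc n)
        = p ^ n * \<bar>z\<bar> / (1 - p ^ Suc n) * norm (euler_coeff p n * z ^ n)"
      using assms by (simp add: euler_coeff_def abs_mult power_abs)
    also have "\<dots> \<le> 1 / 2 * norm (euler_coeff p n * z ^ n)"
      using N[OF n] by (intro mult_right_mono) auto
    finally show "norm (norm (euler_coeff p (Suc n) * z ^ Suc n))
        \<le> 1 / 2 * norm (norm (euler_coeff p n * z ^ n))" by simp
  qed simp
qed

text \<open>The series satisfies E(z) = (1 - z) E(p z). Iteration gives E(z) = (z;p)_n E(z p^n), and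
  continuity at 0 with E(0) = 1 identifies the limit.\<close>

lemma euler_product_sums:
  assumes p: "0 < p" "p < 1"
  shows "(\<lambda>n. euler_coeff p n * z ^ n) sums qpoch_inf z p"
proof -
  define E where "E z = (\<Sum>n. euler_coeff p n * z ^ n)" for z
  have sm: "summable (\<lambda>n. euler_coeff p n * z ^ n)" for z
    using summable_norm_cancel[OF summable_norm_euler_coeff[OF p]] .
  then have E: "(\<lambda>n. euler_coeff p n * z ^ n) sums E z" for z
    unfolding E_def by (rule summable_sums)
  have step: "E z = (1 - z) * E (z * p)" for z
  proof -
    have "(\<lambda>n. euler_coeff p n * z ^ n - euler_coeff p n * (z * p) ^ n) sums (E z - E (z * p))"
      by (intro sums_diff E)
    \<comment> \<open>The constant terms of the two series cancel, so shifting the index needs no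
      correction.\<close>
    then have "(\<lambda>n. euler_coeff p (Suc n) * z ^ Suc n - euler_coeff p (Suc n) * (z * p) ^ Suc n)
        sums (E z - E (z * p))"
      by (subst sums_Suc_iff) simp
    moreover have "euler_coeff p (Suc n) * z ^ Suc n - euler_coeff p (Suc n) * (z * p) ^ Suc n
        = - z * (euler_coeff p n * (z * p) ^ n)" for n
    proof -
      have "euler_coeff p (Suc n) * z ^ Suc n - euler_coeff p (Suc n) * (z * p) ^ Suc n
          = (euler_coeff p (Suc n) * (1 - p ^ Suc n)) * z ^ Suc n"
        by (simp add: power_mult_distrib algebra_simps)
      also have "\<dots> = - z * (euler_coeff p n * (z * p) ^ n)"
        unfolding euler_coeff_Suc[OF p] by (simp add: power_mult_distrib)
      finally show ?thesis .
    qed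
    ultimately have "(\<lambda>n. - z * (euler_coeff p n * (z * p) ^ n)) sums (E z - E (z * p))"
      by simp
    from sums_unique2[OF this sums_mult[OF E]]
    show ?thesis by (simp add: algebra_simps)
  qed
  have iter: "E z = qpoch z p n * E (z * p ^ n)" for n
  proof (induction n)
    case (Suc n)
    then show ?case
      using step[of "z * p ^ n"] by (simp add: qpoch_def mult_ac)
  qed (simp add: qpoch_def)
  have "isCont E 0"
    unfolding E_def by (rule isCont_powser'[where K = 1]) (use sm[of 1] in auto)
  then have "(\<lambda>n. E (z * p ^ n)) \<longlonglongrightarrow> E 0"
    using p by (intro isCont_tendsto_compose[of 0 E] tendsto_mult_right_zero LIMSEQ_power_zero) auto
  then have "(\<lambda>n. qpoch z p n * E (z * p ^ n)) \<longlonglongrightarrow> qpoch_inf z p * E 0"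
    by (intro tendsto_mult qpoch_LIMSEQ p)
  moreover have "E 0 = 1"
    unfolding E_def by simp
  ultimately have "E z = qpoch_inf z p"
    using LIMSEQ_unique[of "\<lambda>_. E z"] by (simp add: iter[symmetric])
  with E[of z] show ?thesis by simp
qed

lemma euler_product_has_sum:
  assumes "0 < p" "p < 1"
  shows "((\<lambda>n. euler_coeff p n * z ^ n) has_sum qpoch_inf z p) UNIV"
  by (intro norm_summable_imp_has_sum summable_norm_euler_coeff euler_product_sums assms)

text \<open>The splitting 1 - p^(s+1) = (1 - p^(s+1-n)) + p^(s+1-n) (1 - p^n) lets the first part
  lower the index of \<open>qpoch\<close> and the second that of \<open>euler_coeff\<close>. This
  gives a two-term recursion for the convolution \<open>C\<close>.\<close>

lemma euler_coeff_convolution: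
  assumes p: "0 < p" "p < 1"
  shows "(\<Sum>n\<le>s. euler_coeff p n / qpoch p p (s - n)) = of_bool (s = 0)"
proof -
  define C where "C s = (\<Sum>n\<le>s. euler_coeff p n / qpoch p p (s - n))" for s
  have nz: "1 - p ^ Suc n \<noteq> 0" for n
    using power_Suc_less_one[of p n] p by auto
  have C: "(1 - p ^ Suc s) * C (Suc s) = (1 - p ^ s) * C s" for s
  proof -
    have "(1 - p ^ Suc s) * C (Suc s)
        = (\<Sum>n\<le>Suc s. (1 - p ^ (Suc s - n)) * (euler_coeff p n / qpoch p p (Suc s - n))
          + p ^ (Suc s - n) * (euler_coeff p n * (1 - p ^ n)) / qpoch p p (Suc s - n))"
      unfolding C_def sum_distrib_left
    proof (rule sum.cong)
      fix n assume "n \<in> {..Suc s}"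
      then have "p ^ Suc s = p ^ (Suc s - n) * p ^ n"
        by (simp flip: power_add)
      then show "(1 - p ^ Suc s) * (euler_coeff p n / qpoch p p (Suc s - n))
        = (1 - p ^ (Suc s - n)) * (euler_coeff p n / qpoch p p (Suc s - n))
          + p ^ (Suc s - n) * (euler_coeff p n * (1 - p ^ n)) / qpoch p p (Suc s - n)"
        by (simp add: add_divide_distrib diff_divide_distrib algebra_simps)
    qed simp
    also have "\<dots> = (\<Sum>n\<le>Suc s. (1 - p ^ (Suc s - n)) * (euler_coeff p n / qpoch p p (Suc s - n)))
        + (\<Sum>n\<le>Suc s. p ^ (Suc s - n) * (euler_coeff p n * (1 - p ^ n)) / qpoch p p (Suc s - n))"
      by (rule sum.distrib)
    \<comment> \<open>The term \<open>n = Suc s\<close> vanishes; in the others the new factor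
      cancels the last factor of \<open>qpoch\<close>.\<close>
    also have "(\<Sum>n\<le>Suc s. (1 - p ^ (Suc s - n)) * (euler_coeff p n / qpoch p p (Suc s - n))) = C s"
      unfolding C_def sum.atMost_Suc
      by (auto intro!: sum.cong simp: Suc_diff_le qpoch_def nz simp del: power_Suc)
         (use nz in \<open>simp add: field_simps\<close>)
    \<comment> \<open>The term \<open>n = 0\<close> vanishes, and the remaining ones are shifted
      down by \<open>euler_coeff_Suc\<close>.\<close>
    also have "(\<Sum>n\<le>Suc s. p ^ (Suc s - n) * (euler_coeff p n * (1 - p ^ n)) / qpoch p p (Suc s - n))
        = - (p ^ s) * C s"
      unfolding C_def sum.atMost_Suc_shift sum_distrib_left euler_coeff_Suc[OF p]
      by (auto intro!: sum.cong simp flip: power_add)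
    finally show ?thesis by (simp add: algebra_simps)
  qed
  have "C (Suc s) = 0" for s
  proof (induction s)
    \<comment> \<open>The recursion carries the factor 1 - p^0 = 0 here, which starts the chain of
      zeros.\<close>
    case 0
    then show ?case using C[of 0] p by simp
  next
    case (Suc s)
    then show ?case using C[of "Suc s"] nz[of "Suc s"] by simp
  qed
  moreover have "C 0 = 1"
    by (simp add: C_def qpoch_def)
  ultimately show ?thesis
    unfolding C_def[symmetric] by (cases s) auto
qed


section \<open>The two inverse sequences on the integers and the q-Bessel kernel\<close>

lemma has_sum_int_of_nat:
  fixes f :: "int \<Rightarrow> 'a :: {comm_monoid_add, topological_space}"
  assumes "\<And>k. k < 0 \<Longrightarrow> f k = 0"
  shows "(f has_sum S) UNIV \<longleftrightarrow> ((\<lambda>n. f (int n)) has_sum S) UNIV"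
proof -
  have "(f has_sum S) UNIV \<longleftrightarrow> (f has_sum S) {0..}"
    by (rule has_sum_cong_neutral) (use assms in auto)
  also have "\<dots> \<longleftrightarrow> ((\<lambda>n. f (int n)) has_sum S) UNIV"
    by (rule has_sum_reindex_bij_witness[of _ int nat]) auto
  finally show ?thesis .
qed

text \<open>
  The two sequences have generating functions $(bz;p)_\infty$ and $1/(bz;p)_\infty$, so they are
  inverse to each other under convolution.
\<close>

definition euler_seq :: "real \<Rightarrow> real \<Rightarrow> int \<Rightarrow> real" where
  "euler_seq p b n = (if n < 0 then 0 else euler_coeff p (nat n) * b ^ nat n)"

definition inv_euler_seq :: "real \<Rightarrow> real \<Rightarrow> int \<Rightarrow> real" where
  "inv_euler_seq p b n = (if n < 0 then 0 else b ^ nat n / qpoch p p (nat n))"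

lemma summable_on_euler_seq:
  assumes "0 < p" "p < 1"
  shows "euler_seq p b summable_on UNIV"
proof -
  have "(euler_seq p b has_sum qpoch_inf b p) UNIV"
    using euler_product_has_sum[OF assms, of b]
    by (subst has_sum_int_of_nat) (auto simp: euler_seq_def)
  then show ?thesis by (rule has_sum_imp_summable)
qed

text \<open>For \<open>k < 0\<close> the product (p^(k+1);p)_inf contains the factor 1 - p^0, so
  both sides vanish; for \<open>k \<ge> 0\<close> the first \<open>k\<close> factors of (p;p)_inf
  are split off. Having one formula for all \<open>k\<close> allows a uniform Euler expansion of the
  kernel.\<close>

lemma inv_euler_seq_eq:
  assumes p: "0 < p" "p < 1" and b: "b > 0"
  shows "inv_euler_seq p b k = b powi k * qpoch_inf (p powi (k + 1)) p / qpoch_inf p p"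
proof (cases "k < 0")
  case True
  \<comment> \<open>This is the position of the zero factor, since (k + 1) + m = 0.\<close>
  define m where "m = nat (- k - 1)"
  have "p powi (k + 1) * p ^ m = 1"
    using p True by (simp add: m_def power_int_def flip: power_mult_distrib)
  then have "qpoch (p powi (k + 1)) p (Suc m) = 0"
    by (simp add: qpoch_def)
  then show ?thesis
    using qpoch_inf_eq_qpoch_mult[OF p, of "p powi (k + 1)" "Suc m"] True
    by (simp add: inv_euler_seq_def)
next
  case False
  have "p powi (k + 1) = p * p ^ nat k"
    using False p by (simp add: power_int_def nat_add_distrib)
  then have "qpoch_inf p p = qpoch p p (nat k) * qpoch_inf (p powi (k + 1)) p"
    using qpoch_inf_eq_qpoch_mult[OF p, of p "nat k"] by simp
  moreover have "qpoch_inf p p \<noteq> 0"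
    using qpoch_inf_nonzero[of p p] p by simp
  ultimately show ?thesis
    using False by (auto simp: inv_euler_seq_def power_int_def)
qed

text \<open>The numbers 1/(p;p)_n converge because (p;p)_inf is nonzero, hence they are bounded and
  \<open>b < 1\<close> gives a geometric majorant.\<close>

lemma summable_on_inv_euler_seq:
  assumes p: "0 < p" "p < 1" and b: "0 < b" "b < 1"
  shows "inv_euler_seq p b summable_on UNIV"
proof -
  have nz: "qpoch_inf p p \<noteq> 0"
    using qpoch_inf_nonzero[of p p] p by simp
  have "(\<lambda>n. qpoch p p n) \<longlonglongrightarrow> qpoch_inf p p"
    using qpoch_LIMSEQ[OF p] by simp
  then have "(\<lambda>n. inverse (qpoch p p n)) \<longlonglongrightarrow> inverse (qpoch_inf p p)"
    using nz by (rule tendsto_inverse)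
  then have "Bseq (\<lambda>n. inverse (qpoch p p n))"
    by (rule convergent_imp_Bseq[OF convergentI])
  then obtain B where B: "\<And>n. \<bar>inverse (qpoch p p n)\<bar> \<le> B"
    unfolding Bseq_def by auto
  have geo: "(\<lambda>n. b ^ n) summable_on UNIV"
    by (rule norm_summable_imp_summable_on) (use b in \<open>auto intro!: summable_geometric\<close>)
  have "(\<lambda>n. b ^ n / qpoch p p n) summable_on UNIV"
  proof (rule summable_on_real_comparison)
    show "(\<lambda>n. B * b ^ n) summable_on UNIV"
      by (intro summable_on_cmult_right geo)
    show "\<bar>b ^ n / qpoch p p n\<bar> \<le> B * b ^ n" for n
      using mult_right_mono[OF B[of n], of "b ^ n"] b by (simp add: abs_mult divide_inverse mult_ac)
  qed
  then obtain S where "((\<lambda>n. b ^ n / qpoch p p n) has_sum S) UNIV"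
    by (auto simp: summable_on_def)
  then have "(inv_euler_seq p b has_sum S) UNIV"
    by (subst has_sum_int_of_nat) (auto simp: inv_euler_seq_def)
  then show ?thesis by (rule has_sum_imp_summable)
qed

lemma euler_seq_convolution:
  assumes p: "0 < p" "p < 1"
  shows "((\<lambda>n. euler_seq p b n * inv_euler_seq p b (s - n)) has_sum of_bool (s = 0)) UNIV"
proof (cases "s < 0")
  case True
  then have "(\<lambda>n. euler_seq p b n * inv_euler_seq p b (s - n)) = (\<lambda>_. 0)"
    by (auto simp: euler_seq_def inv_euler_seq_def)
  then show ?thesis using True by simp
next
  case False
  then obtain t where s: "s = int t"
    by (metis nonneg_int_cases not_less)
  have "(\<Sum>n\<le>t. euler_seq p b (int n) * inv_euler_seq p b (s - int n))
      = (\<Sum>n\<le>t. b ^ t * (euler_coeff p n / qpoch p p (t - n)))"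
  proof (rule sum.cong)
    fix n assume "n \<in> {..t}"
    then have "nat (s - int n) = t - n" "b ^ t = b ^ n * b ^ (t - n)" "\<not> s - int n < 0"
      by (auto simp: s simp flip: power_add)
    then show "euler_seq p b (int n) * inv_euler_seq p b (s - int n)
        = b ^ t * (euler_coeff p n / qpoch p p (t - n))"
      by (simp add: euler_seq_def inv_euler_seq_def)
  qed simp
  also have "\<dots> = of_bool (s = 0)"
    unfolding sum_distrib_left[symmetric] euler_coeff_convolution[OF p] by (cases t) (simp_all add: s)
  finally have "((\<lambda>n. euler_seq p b (int n) * inv_euler_seq p b (s - int n)) has_sum of_bool (s = 0)) UNIV"
    by (intro has_sum_finite_neutralI[of "{..t}"]) (auto simp: inv_euler_seq_def s)
  then show ?thesis
    by (subst has_sum_int_of_nat) (auto simp: euler_seq_def)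
qed

text \<open>
  Expanding $(p^{n+k+1};p)_\infty$ by Euler's formula and interchanging the two sums, the inner sum
  is again an Euler series, now for $(b^2p^m;p)_\infty = (b^2;p)_\infty / (b^2;p)_m$.
\<close>

lemma euler_correlation_eq_bessel:
  assumes p: "0 < p" "p < 1" and b: "0 < b" "b < 1"
  shows "(\<Sum>\<^sub>\<infinity>n. euler_seq p b n * inv_euler_seq p b (n + k))
      = b powi k * (qpoch_inf (b\<^sup>2) p / qpoch_inf p p)
        * (\<Sum>m. euler_coeff p m * p ^ m / qpoch (b\<^sup>2) p m * (p powi k) ^ m)"
proof -
  define P where "P z = qpoch_inf z p" for z
  define w where "w = p powi (k + 1)"
  have b2: "b\<^sup>2 < 1"
    using b by (simp add: power_less_one_iff abs_square_less_1)
  note euler = euler_product_has_sum[OF p, folded P_def]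
  \<comment> \<open>The cross factor p^(mn) can be absorbed either as (w p^n)^m or as (b^2 p^m)^n,
    so each order of summation meets an Euler series.\<close>
  define T where "T = (\<lambda>(m, n). (euler_coeff p m * w ^ m) * (euler_coeff p n * (b\<^sup>2) ^ n) * p ^ (m * n))"
  have "T summable_on UNIV \<times> UNIV"
  proof (rule summable_on_real_comparison)
    show "(\<lambda>(m, n). \<bar>euler_coeff p m * w ^ m\<bar> * \<bar>euler_coeff p n * (b\<^sup>2) ^ n\<bar>) summable_on UNIV \<times> UNIV"
      by (intro summable_on_times summable_on_real_abs has_sum_imp_summable[OF euler])
    fix x :: "nat \<times> nat"
    obtain m n where x: "x = (m, n)" by (cases x)
    have "\<bar>p ^ (m * n)\<bar> \<le> 1"
      using p by (simp add: power_le_one)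
    from mult_left_mono[OF this, of "\<bar>euler_coeff p m * w ^ m\<bar> * \<bar>euler_coeff p n * (b\<^sup>2) ^ n\<bar>"]
    show "\<bar>T x\<bar> \<le> (\<lambda>(m, n). \<bar>euler_coeff p m * w ^ m\<bar> * \<bar>euler_coeff p n * (b\<^sup>2) ^ n\<bar>) x"
      by (simp add: x T_def abs_mult)
  qed
  then obtain S where S: "(T has_sum S) (UNIV \<times> UNIV)"
    by (auto simp: summable_on_def)
  have rows: "((\<lambda>m. (euler_coeff p m * w ^ m) * P (b\<^sup>2 * p ^ m)) has_sum S) UNIV"
  proof (rule has_sum_SigmaD[OF S])
    fix m
    show "((\<lambda>n. T (m, n)) has_sum (euler_coeff p m * w ^ m) * P (b\<^sup>2 * p ^ m)) UNIV"
      using has_sum_cmult_right[OF euler[of "b\<^sup>2 * p ^ m"], of "euler_coeff p m * w ^ m"]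
      by (simp add: T_def power_mult_distrib power_mult mult_ac)
  qed
  have cols: "((\<lambda>n. (euler_coeff p n * (b\<^sup>2) ^ n) * P (w * p ^ n)) has_sum S) UNIV"
  proof (rule has_sum_SigmaD)
    show "((\<lambda>(n, m). T (m, n)) has_sum S) (UNIV \<times> UNIV)"
      using S has_sum_swap by blast
    fix n
    show "((\<lambda>m. (\<lambda>(n, m). T (m, n)) (n, m)) has_sum (euler_coeff p n * (b\<^sup>2) ^ n) * P (w * p ^ n)) UNIV"
      using has_sum_cmult_right[OF euler[of "w * p ^ n"], of "euler_coeff p n * (b\<^sup>2) ^ n"]
      by (simp add: T_def power_mult_distrib power_mult[symmetric] mult_ac)
  qed
  have "(\<lambda>m. euler_coeff p m * w ^ m * P (b\<^sup>2 * p ^ m)) sums S"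
    using has_sum_imp_sums[OF rows] .
  moreover have "euler_coeff p m * w ^ m * P (b\<^sup>2 * p ^ m)
      = P (b\<^sup>2) * (euler_coeff p m * p ^ m / qpoch (b\<^sup>2) p m * (p powi k) ^ m)" for m
  proof -
    have "w = p * p powi k"
      using p by (simp add: w_def power_int_add)
    moreover have "P (b\<^sup>2) = qpoch (b\<^sup>2) p m * P (b\<^sup>2 * p ^ m)"
      unfolding P_def by (rule qpoch_inf_eq_qpoch_mult[OF p])
    ultimately show ?thesis
      using qpoch_pos[OF p b2, of m] by (simp add: power_mult_distrib)
  qed
  ultimately have "(\<lambda>m. P (b\<^sup>2) * (euler_coeff p m * p ^ m / qpoch (b\<^sup>2) p m * (p powi k) ^ m)) sums S"
    by simp
  moreover have "P (b\<^sup>2) \<noteq> 0"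
    unfolding P_def by (rule qpoch_inf_nonzero[OF p b2])
  \<comment> \<open>Division by the nonzero (b^2;p)_inf also yields the convergence of the q-Bessel
    series.\<close>
  ultimately have "(\<lambda>m. euler_coeff p m * p ^ m / qpoch (b\<^sup>2) p m * (p powi k) ^ m) sums (S / P (b\<^sup>2))"
    by (rule sums_mult_D)
  then have S_eq: "S = P (b\<^sup>2) * (\<Sum>m. euler_coeff p m * p ^ m / qpoch (b\<^sup>2) p m * (p powi k) ^ m)"
    using \<open>P (b\<^sup>2) \<noteq> 0\<close> by (simp add: sums_iff)
  have "((\<lambda>n. euler_seq p b n * inv_euler_seq p b (n + k)) has_sum b powi k / P p * S) UNIV"
  proof (subst has_sum_int_of_nat)
    \<comment> \<open>The powers b^n and b^(n+k) combine to b^k (b^2)^n; this is how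
      \<open>b\<^sup>2\<close> becomes the Euler argument.\<close>
    have "euler_seq p b (int n) * inv_euler_seq p b (int n + k)
        = b powi k / P p * (euler_coeff p n * (b\<^sup>2) ^ n * P (w * p ^ n))" for n
    proof -
      have "p powi (int n + k + 1) = w * p ^ n" "b powi (int n + k) = b powi k * b ^ n"
        using p b by (simp_all add: w_def power_int_add)
      then show ?thesis
        using inv_euler_seq_eq[OF p b(1), of "int n + k"]
        by (simp add: euler_seq_def P_def power_mult_distrib power2_eq_square)
    qed
    then show "((\<lambda>n. euler_seq p b (int n) * inv_euler_seq p b (int n + k)) has_sum b powi k / P p * S) UNIV"
      using has_sum_cmult_right[OF cols, of "b powi k / P p"] by (simp only:)
  qed (auto simp: euler_seq_def)
  then show ?thesis
    by (simp add: infsumI S_eq P_def)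
qed


section \<open>The q-Bessel Fourier transform as an isometry of l^2\<close>

lemma powi_mult_powr:
  fixes q \<nu> :: real
  assumes "0 < q"
  shows "q powi n * (q powi n) powr (2 * \<nu> + 1) = (q powr (\<nu> + 1)) powi n * (q powr (\<nu> + 1)) powi n"
proof -
  have "q powi n = q powr real_of_int n"
    using assms by (simp add: powr_real_of_int')
  moreover have "(q powr (\<nu> + 1)) powi n = q powr ((\<nu> + 1) * real_of_int n)"
    using assms by (simp add: powr_real_of_int'[symmetric] powr_powr)
  ultimately show ?thesis
    using assms by (simp add: powr_powr algebra_simps flip: powr_add)
qed

theorem theorem3:
  fixes q \<nu> :: real and f :: "real \<Rightarrow> real"
  assumes "0 < q" and "q < 1" and "\<nu> > -1"
    and "f \<in> Lq2_space q \<nu>"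
  shows "(\<forall>x \<in> Rq_plus q.
            jackson_integrable q (\<lambda>t. f t * qBessel q \<nu> (x * t) * t powr (2 * \<nu> + 1)))
       \<and> qBessel_Fourier q \<nu> f \<in> Lq2_space q \<nu>
       \<and> Lq2_norm q \<nu> (qBessel_Fourier q \<nu> f) = Lq2_norm q \<nu> f"
proof -
  define p b where "p = q\<^sup>2" and "b = q powr (\<nu> + 1)"
  have p: "0 < p" "p < 1"
    using assms by (auto simp: p_def power_less_one_iff)
  \<comment> \<open>The bound \<open>b < 1\<close> is where \<open>\<nu> > -1\<close>
    enters.\<close>
  have b: "0 < b" "b < 1"
    using assms powr_less_mono'[of q 0 "\<nu> + 1"] by (auto simp: b_def)
  have b2: "q powr (2 * \<nu> + 2) = b\<^sup>2"
    by (simp add: b_def power2_eq_square flip: powr_add)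
  \<comment> \<open>The Jackson weight at q^n is b^n * b^n: one factor goes into \<open>g\<close>,
    the other into the kernel.\<close>
  note weight = powi_mult_powr[OF assms(1), of _ \<nu>, folded b_def]
  define g where "g n = f (q powi n) * b powi n" for n
  define K where "K k = (\<Sum>\<^sub>\<infinity>n. euler_seq p b n * inv_euler_seq p b (n + k))" for k
  \<comment> \<open>This is \<open>qBessel_const\<close> without its factor 1/(1 - q).\<close>
  define C where "C = qpoch_inf (b\<^sup>2) p / qpoch_inf p p"
  have C: "C \<noteq> 0"
    using qpoch_inf_nonzero[OF p, of "b\<^sup>2"] qpoch_inf_nonzero[OF p p(2)] b
    by (simp add: C_def power_less_one_iff abs_square_less_1)
  have bessel: "K k = b powi k * C * qBessel q \<nu> (q powi k)" for k
  proof -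
    have "euler_coeff p m * p ^ m / qpoch (b\<^sup>2) p m * (p powi k) ^ m
        = (-1) ^ m * q ^ (m * (m + 1)) / (qpoch (b\<^sup>2) p m * qpoch p p m) * (q powi k) ^ (2 * m)" for m
    proof -
      have "(p powi k) ^ m = (q powi k) ^ (2 * m)"
        by (simp add: p_def power2_eq_square power_int_mult_distrib power_mult)
      then show ?thesis
        using euler_coeff_eq[of q m] by (simp add: p_def)
    qed
    then show ?thesis
      unfolding K_def euler_correlation_eq_bessel[OF p b] qBessel_def b2 C_def p_def[symmetric] by simp
  qed
  note orth = correlation_of_inverses[OF summable_on_euler_seq[OF p] summable_on_inv_euler_seq[OF p b]
      euler_seq_convolution[OF p], folded K_def]
  \<comment> \<open>Stated for an arbitrary \<open>h\<close>, since it is applied both to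
    \<open>f\<close> and to its transform.\<close>
  have norm_weight: "q powi n * (\<bar>h (q powi n)\<bar>\<^sup>2 * (q powi n) powr (2 * \<nu> + 1)) = (h (q powi n) * b powi n)\<^sup>2"
    for h n
    using weight[of n] by (simp add: power2_eq_square mult_ac)
  have g: "(\<lambda>n. (g n)\<^sup>2) summable_on UNIV"
    using assms(4) unfolding Lq2_space_def jackson_integrable_def g_def norm_weight by simp
  note G = has_sum_power2_orthonormal[OF g orth]
  \<comment> \<open>Replacing \<open>qBessel\<close> at q^(m+n) by K(m+n) / (b^(m+n) C) cancels one
    b^n of the weight; the other b^n makes \<open>g n\<close>.\<close>
  have integrand: "q powi n * (f (q powi n) * qBessel q \<nu> (q powi m * q powi n) * (q powi n) powr (2 * \<nu> + 1))
      = 1 / (b powi m * C) * (g n * K (m + n))" for m n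
  proof -
    have "q powi m * q powi n = q powi (m + n)" "b powi (m + n) = b powi m * b powi n"
      using assms b by (simp_all add: power_int_add)
    moreover have "b powi m \<noteq> 0"
      using b by simp
    ultimately show ?thesis
      using weight[of n] C by (simp add: g_def bessel field_simps)
  qed
  have "jackson_integrable q (\<lambda>t. f t * qBessel q \<nu> (x * t) * t powr (2 * \<nu> + 1))" if "x \<in> Rq_plus q" for x
  proof -
    from that obtain m where x: "x = q powi m"
      by (auto simp: Rq_plus_def)
    show ?thesis
      unfolding jackson_integrable_def x integrand by (intro summable_on_cmult_right G)
  qed
  \<comment> \<open>The weight b^m and the constants 1 - q and \<open>C\<close> cancel exactly, so
    the weighted transform is the sum of \<open>g\<close> against the translate of
    \<open>K\<close>.\<close>
  moreover have F: "qBessel_Fourier q \<nu> f (q powi m) * b powi m = (\<Sum>\<^sub>\<infinity>n. g n * K (m + n))" for m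
  proof -
    have "jackson_integral q (\<lambda>t. f t * qBessel q \<nu> (q powi m * t) * t powr (2 * \<nu> + 1))
        = (1 - q) * (1 / (b powi m * C) * (\<Sum>\<^sub>\<infinity>n. g n * K (m + n)))"
      unfolding jackson_integral_def integrand infsum_cmult_right' ..
    moreover have "qBessel_const q \<nu> = 1 / (1 - q) * C"
      by (simp add: qBessel_const_def b2 C_def p_def)
    moreover have "b powi m \<noteq> 0"
      using b by simp
    ultimately show ?thesis
      using C assms(2) by (simp add: qBessel_Fourier_def)
  qed
  have "qBessel_Fourier q \<nu> f \<in> Lq2_space q \<nu>"
    unfolding Lq2_space_def jackson_integrable_def mem_Collect_eq norm_weight F
    using G(2) by (rule has_sum_imp_summable)
  \<comment> \<open>Both norms carry the same factor 1 - q under the root, so equality of the l^2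
    sums suffices.\<close>
  moreover have "Lq2_norm q \<nu> (qBessel_Fourier q \<nu> f) = Lq2_norm q \<nu> f"
    unfolding Lq2_norm_def jackson_integral_def norm_weight F infsumI[OF G(2)] by (simp add: g_def)
  ultimately show ?thesis by blast
qed

end
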